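(* Let $a\in\mathbb{C}$, let $h(x)=\frac{x^3}{3}+ax$, let $n\ge 0$ be an integer, and let $p(x)$ be a wave polynomial of degree $n$. For any polynomial $r(x)\in\mathbb{C}[x]$ with $\deg r(x)\le n$, there exists $c\in\mathbb{C}$ such that $$r(x)\,p(-x)\ \sim\ \frac{c}{p^2(x)}.$$
   Context: A wave polynomial of degree $n$ is a nonzero polynomial $p(x)\in\mathbb{C}[x]$ for which there exists $b\in\mathbb{C}$ such that $y=p$ satisfies $y''(x)-h'(x)y'(x)+(nx+b)y(x)=0$; such a polynomial has degree exactly $n$ and only simple roots. Define the linear map $D:\mathbb{C}(x)\to\mathbb{C}(x)$ by $D(q)=q'+h'q$, and let $C=D(\mathbb{C}(x))$ be its image. For $q_1,q_2\in\mathbb{C}(x)$, write $q_1\sim q_2$ if and only if $q_1-q_2\in C$. Here $p^2(x)=(p(x))^2$. *)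

theory Defs
  imports Complex_Main "HOL-Computational_Algebra.Computational_Algebra"
begin

text \<open>
  The field of rational functions over the complex numbers is rendered as
  \<^typ>\<open>complex poly fract\<close>, with \<^const>\<open>to_fract\<close> embedding the polynomials.
  The library has no derivation on this type; it is given here by the quotient rule, which
  determines the value independently of the representation (\<open>fract_deriv_Fract\<close>).
\<close>

definition fract_deriv :: "'a::idom poly fract \<Rightarrow> 'a poly fract" where
  "fract_deriv q = (THE d. \<exists>u v. v \<noteq> 0 \<and> q = Fract u v \<and>
     d = Fract (pderiv u * v - u * pderiv v) (v^2))"

lemma fract_deriv_Fract:
  fixes a b :: "'a::idom poly"
  assumes b: "b \<noteq> 0"
  shows "fract_deriv (Fract a b) = Fract (pderiv a * b - a * pderiv b) (b^2)"
proof -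
  have "Fract (pderiv c * d - c * pderiv d) (d\<^sup>2) = Fract (pderiv a * b - a * pderiv b) (b\<^sup>2)"
    if d: "d \<noteq> 0" and q: "Fract a b = Fract c d" for c d
  proof -
    have eq: "a * d = c * b"
      using b d q by (simp add: eq_fract)
    have d_eq: "a * pderiv d + pderiv a * d = c * pderiv b + pderiv c * b"
      using arg_cong[OF eq, of pderiv] by (simp add: pderiv_mult algebra_simps)
    have "(pderiv a * b - a * pderiv b) * d\<^sup>2 - (pderiv c * d - c * pderiv d) * b\<^sup>2
        = b * d * ((a * pderiv d + pderiv a * d) - (c * pderiv b + pderiv c * b))
          - (b * pderiv d + d * pderiv b) * (a * d - c * b)"
      by (simp add: algebra_simps power2_eq_square)
    also have "\<dots> = 0"
      by (simp add: eq d_eq)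
    finally show ?thesis
      using b d by (simp add: eq_fract)
  qed
  then show ?thesis
    unfolding fract_deriv_def by (intro the_equality) (use b in blast)+
qed

lemma fract_deriv_to_fract [simp]: "fract_deriv (to_fract p) = to_fract (pderiv p)"
  by (simp add: to_fract_def fract_deriv_Fract)

definition wave_D :: "complex poly \<Rightarrow> complex poly fract \<Rightarrow> complex poly fract" where
  "wave_D h q = fract_deriv q + to_fract (pderiv h) * q"

definition wave_C :: "complex poly \<Rightarrow> complex poly fract set" where
  "wave_C h = range (wave_D h)"

definition wave_sim :: "complex poly \<Rightarrow> complex poly fract \<Rightarrow> complex poly fract \<Rightarrow> bool" where
  "wave_sim h q1 q2 \<longleftrightarrow> q1 - q2 \<in> wave_C h"

text \<open>
  The condition \<open>degree p = n\<close> is not part of the definition: for cubic \<open>h\<close> as below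
  it follows from the equation.
\<close>

definition wave_polynomial :: "complex poly \<Rightarrow> nat \<Rightarrow> complex poly \<Rightarrow> bool" where
  "wave_polynomial h n p \<longleftrightarrow> p \<noteq> 0 \<and>
     (\<exists>b. pderiv (pderiv p) - pderiv h * pderiv p + [:b, of_nat n:] * p = 0)"

lemma wave_polynomial_degree:
  assumes "wave_polynomial [:0, a, 0, 1/3:] n p"
  shows "degree p = n"
proof -
  from assms obtain b where p: "p \<noteq> 0"
    and eq: "pderiv (pderiv p) - pderiv [:0, a, 0, 1/3:] * pderiv p + [:b, of_nat n:] * p = 0"
    unfolding wave_polynomial_def by blast
  let ?d = "degree p"
  have h': "pderiv [:0, a, 0, 1/3:] = [:a, 0, 1:]"
    by (simp add: pderiv_pCons)
  have z: "coeff p (Suc k) = 0" if "k \<ge> ?d" for k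
    using that by (simp add: coeff_eq_0)
  have "coeff (pCons 0 (pderiv p)) ?d = of_nat ?d * lead_coeff p"
    by (cases ?d) (simp_all add: coeff_pderiv)
  moreover have "coeff (pderiv (pderiv p) - [:a, 0, 1:] * pderiv p + [:b, of_nat n:] * p) (Suc ?d) = 0"
    using eq unfolding h' by simp
  ultimately have "(of_nat n - of_nat ?d) * lead_coeff p = 0"
    by (simp add: coeff_pderiv z algebra_simps)
  with p show ?thesis
    by simp
qed

end

theory Submission
  imports Defs "HOL-Computational_Algebra.Field_as_Ring"
begin

text \<open>
  Write \<open>P x = p (-x)\<close> and \<open>h' x = x^2 + a\<close>. Besides \<open>p\<close>, the wave equation has the
  solution \<open>p E\<close> with \<open>E' = exp h / p^2\<close>. The operator \<open>(d/dx)^(n+1)\<close> intertwines the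
  wave equation with the equation satisfied by \<open>P exp h\<close>, and it maps \<open>p E\<close> to
  \<open>S exp h\<close> with \<open>S\<close> rational, because \<open>p\<close> has degree \<open>n\<close>. Comparing Wronskians,
  \<open>S\<close> is a multiple of \<open>P\<close>; it is nonzero by a degree count. On the other hand the
  \<open>n\<close>-th derivative of \<open>p E\<close> is \<open>p^(n) E + R exp h\<close> with \<open>R\<close> rational and \<open>p^(n)\<close>
  constant, so differentiating once more gives \<open>S = p^(n) / p^2 + D R\<close>. Hence
  \<open>P\<close> is equivalent to a multiple of \<open>1 / p^2\<close>. Finally \<open>D (s' P - s P')\<close> is
  \<open>(s'' + h' s' - (n x - b) s) P\<close>, and this reduces \<open>r P\<close> to a multiple of \<open>P\<close> by
  lowering the degree of \<open>r\<close>.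
\<close>

section \<open>The derivation on rational functions\<close>

lemma fract_deriv_add: "fract_deriv (f + g) = fract_deriv f + fract_deriv g"
proof (cases f, cases g)
  fix u v s t :: "'a poly"
  assume f: "f = Fract u v" and v: "v \<noteq> 0" and g: "g = Fract s t" and t: "t \<noteq> 0"
  show ?thesis
    unfolding f g using v t
    by (simp add: fract_deriv_Fract eq_fract pderiv_add pderiv_mult algebra_simps power2_eq_square)
qed

lemma fract_deriv_mult: "fract_deriv (f * g) = fract_deriv f * g + f * fract_deriv g"
proof (cases f, cases g)
  fix u v s t :: "'a poly"
  assume f: "f = Fract u v" and v: "v \<noteq> 0" and g: "g = Fract s t" and t: "t \<noteq> 0"
  show ?thesis
    unfolding f g using v t
    by (simp add: fract_deriv_Fract eq_fract pderiv_add pderiv_mult algebra_simps power2_eq_square)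
qed

lemma fract_deriv_0 [simp]: "fract_deriv 0 = 0"
  using fract_deriv_to_fract[of 0] by simp

lemma fract_deriv_1 [simp]: "fract_deriv 1 = 0"
  using fract_deriv_to_fract[of 1] by simp

lemma fract_deriv_minus: "fract_deriv (- f) = - fract_deriv f"
  using fract_deriv_add[of f "- f"] by (simp add: eq_neg_iff_add_eq_0 add.commute)

lemma fract_deriv_diff: "fract_deriv (f - g) = fract_deriv f - fract_deriv g"
  using fract_deriv_add[of f "- g"] by (simp add: fract_deriv_minus)

lemma fract_deriv_of_nat [simp]: "fract_deriv (of_nat k) = 0"
  by (induction k) (simp_all add: fract_deriv_add)

lemma fract_deriv_numeral [simp]: "fract_deriv (numeral k) = 0"
  using fract_deriv_of_nat[of "numeral k"] by (simp del: fract_deriv_of_nat)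

lemma to_fract_of_nat [simp]: "to_fract (of_nat k) = of_nat k"
  by (induction k) simp_all

lemma fract_deriv_power_Suc:
  "fract_deriv (f ^ Suc k) = of_nat (Suc k) * f ^ k * fract_deriv f"
  by (induction k) (simp_all add: fract_deriv_mult algebra_simps)

lemma to_fract_power [simp]: "to_fract (x ^ k) = to_fract x ^ k"
  by (induction k) simp_all

lemma fract_deriv_inverse:
  assumes "f \<noteq> 0"
  shows "fract_deriv (inverse f) = - fract_deriv f * inverse (f ^ 2)"
proof -
  have "fract_deriv (inverse f) * f + inverse f * fract_deriv f = 0"
    using fract_deriv_mult[of "inverse f" f] assms by simp
  then have "fract_deriv (inverse f) * f = - inverse f * fract_deriv f"
    by (simp add: add_eq_0_iff2)
  then have "fract_deriv (inverse f) * f * inverse f = - inverse f * fract_deriv f * inverse f"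
    by simp
  then show ?thesis
    using assms by (simp add: power2_eq_square mult.assoc)
qed

text \<open>In lowest terms, \<open>u' v = u v'\<close> makes \<open>v\<close> divide
  \<open>v'\<close> and \<open>u\<close> divide \<open>u'\<close>; in characteristic 0 only
  constants divide their own derivative.\<close>

lemma fract_deriv_eq_0D:
  fixes f :: "'a::{field_gcd, field_char_0} poly fract"
  assumes "fract_deriv f = 0"
  shows "\<exists>c. f = to_fract [:c:]"
proof -
  obtain u v where uv: "f = Fract u v" "v \<noteq> 0" "coprime u v"
    by (metis Fract_quot_of_fract coprime_quot_of_fract snd_quot_of_fract_nonzero)
  have const: "degree w = 0" if "w dvd pderiv w" for w :: "'a poly"
    using that by (metis not_dvd_pderiv)
  from assms uv have eq: "pderiv u * v = u * pderiv v"
    by (simp add: fract_deriv_Fract Zero_fract_def eq_fract)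
  have "v dvd pderiv v"
    using uv(3) eq by (metis coprime_commute coprime_dvd_mult_right_iff dvd_triv_right)
  moreover have "u dvd pderiv u"
    using uv(3) eq by (metis coprime_dvd_mult_left_iff dvd_triv_left)
  ultimately obtain c d where "u = [:c:]" "v = [:d:]"
    by (metis const degree_eq_zeroE)
  with uv show ?thesis
    by (intro exI[of _ "c / d"]) (simp add: to_fract_def eq_fract)
qed

text \<open>For \<open>w = u / v\<close> the equation reads \<open>g u v = u v' - u' v\<close>. If
  \<open>u\<close> is nonzero, the left side has degree at least that of \<open>u v\<close>, the
  right side a smaller one.\<close>

lemma rational_homogeneous_ode_trivial:
  fixes w :: "'a::field_char_0 poly fract"
  assumes ode: "fract_deriv w + to_fract g * w = 0" and g: "g \<noteq> 0"
  shows "w = 0"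
proof (cases w)
  case (Fract u v)
  have "(pderiv u * v - u * pderiv v) * v + g * u * v * v = 0"
    using ode Fract
    by (simp add: fract_deriv_Fract to_fract_def eq_fract Zero_fract_def power2_eq_square algebra_simps)
  then have "(pderiv u * v - u * pderiv v + g * u * v) * v = 0"
    by (simp add: algebra_simps)
  with Fract have "pderiv u * v - u * pderiv v + g * u * v = 0"
    by simp
  then have eq: "g * u * v = u * pderiv v - pderiv u * v"
    by (simp add: algebra_simps)
  have "u = 0"
  proof (rule ccontr)
    assume u: "u \<noteq> 0"
    have ge: "degree u + degree v \<le> degree (u * pderiv v - pderiv u * v)"
      unfolding eq[symmetric] using u g Fract by (simp add: degree_mult_eq)
    have nz: "u * pderiv v - pderiv u * v \<noteq> 0"
      unfolding eq[symmetric] using u g Fract by simp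
    have less: "degree (x * pderiv y) < degree x + degree y \<or> pderiv y = 0" for x y :: "'a poly"
    proof (cases "degree y = 0")
      case True
      then show ?thesis by (metis degree_eq_zeroE pderiv_singleton)
    next
      case False
      then show ?thesis
        using degree_mult_le[of x "pderiv y"] degree_pderiv[of y] by linarith
    qed
    \<comment> \<open>If a derivative is zero, its product vanishes and the degree of the other
      product decides alone.\<close>
    consider "pderiv u = 0" | "pderiv v = 0"
      | "degree (u * pderiv v) < degree u + degree v" "degree (v * pderiv u) < degree u + degree v"
      using less[of u v] less[of v u] by (auto simp: add.commute)
    then show False
    proof cases
      case 1
      then show False using less[of u v] ge nz by auto
    next
      case 2
      then show False using less[of v u] ge nz by (auto simp: mult.commute add.commute)
    next
      case 3
      then show False
        using degree_diff_less[OF 3] ge by (simp add: mult.commute)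
    qed
  qed
  then show ?thesis
    using Fract by (simp add: eq_fract Zero_fract_def)
qed

section \<open>The relation \<open>\<sim>\<close>\<close>

lemma wave_D_add: "wave_D h (f + g) = wave_D h f + wave_D h g"
  by (simp add: wave_D_def fract_deriv_add algebra_simps)

lemma wave_D_scale: "wave_D h (to_fract [:c:] * f) = to_fract [:c:] * wave_D h f"
  by (simp add: wave_D_def fract_deriv_mult algebra_simps)

lemma wave_D_to_fract: "wave_D h (to_fract q) = to_fract (pderiv q + pderiv h * q)"
  by (simp add: wave_D_def)

lemma wave_simI: "f = g + wave_D h q \<Longrightarrow> wave_sim h f g"
  by (simp add: wave_sim_def wave_C_def)

lemma wave_simE:
  assumes "wave_sim h f g"
  obtains q where "f = g + wave_D h q"
proof -
  from assms obtain q where "f - g = wave_D h q"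
    unfolding wave_sim_def wave_C_def by blast
  then show ?thesis
    by (intro that[of q]) (metis add.commute diff_add_cancel)
qed

lemma wave_sim_trans:
  assumes "wave_sim h f g" and "wave_sim h g k"
  shows "wave_sim h f k"
proof -
  obtain q1 where "f = g + wave_D h q1"
    using assms(1) by (rule wave_simE)
  moreover obtain q2 where "g = k + wave_D h q2"
    using assms(2) by (rule wave_simE)
  ultimately show ?thesis
    by (intro wave_simI[of _ _ _ "q2 + q1"]) (simp only: wave_D_add add.assoc)
qed

lemma wave_sim_scale:
  assumes "wave_sim h f g"
  shows "wave_sim h (to_fract [:c:] * f) (to_fract [:c:] * g)"
proof -
  obtain q where "f = g + wave_D h q"
    using assms by (rule wave_simE)
  then show ?thesis
    by (intro wave_simI[of _ _ _ "to_fract [:c:] * q"]) (simp only: wave_D_scale distrib_left)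
qed

section \<open>Iterated derivatives of the second solution\<close>

text \<open>
  The derivative of order \<open>k\<close> of \<open>y'' - h' y' + (N x + B) y\<close>, where \<open>y k\<close> stands for the
  derivative of order \<open>k\<close> of \<open>y\<close> and \<open>h'' = 2 x\<close>. The truncated index \<open>k - 1\<close> at \<open>k = 0\<close> is
  harmless, since its coefficient vanishes.
\<close>

definition wave_rec ::
    "'a::idom poly fract \<Rightarrow> 'a poly fract \<Rightarrow> 'a poly fract \<Rightarrow> 'a poly fract \<Rightarrow>
     (nat \<Rightarrow> 'a poly fract) \<Rightarrow> nat \<Rightarrow> 'a poly fract" where
  "wave_rec H X B N y k = y (Suc (Suc k)) - H * y (Suc k) + ((N - 2 * of_nat k) * X + B) * y k
     + of_nat k * (N + 1 - of_nat k) * y (k - 1)"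

text \<open>The twist \<open>w = H\<close> models differentiation of a factor of
  \<open>exp h\<close>, and \<open>d k * g\<close> is a source. The coefficients shift by
  \<open>H' = 2 X\<close> and \<open>k (N + 1 - k) + (N - 2 k) = (k + 1) (N - k)\<close>.\<close>

lemma wave_rec_Suc:
  assumes H: "fract_deriv H = 2 * X" and X: "fract_deriv X = 1"
    and B: "fract_deriv B = 0" and N: "fract_deriv N = 0"
    and y: "\<And>k. y (Suc k) = fract_deriv (y k) + w * y k + d k * g"
  shows "wave_rec H X B N y (Suc k)
    = fract_deriv (wave_rec H X B N y k) + w * wave_rec H X B N y k + wave_rec H X B N d k * g"
proof -
  have dy: "fract_deriv (y k) = y (Suc k) - w * y k - d k * g" for k
    by (simp add: y)
  show ?thesis
    by (cases k)
      (simp_all add: wave_rec_def fract_deriv_add fract_deriv_diff fract_deriv_mult H X B N dy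
        algebra_simps)
qed

text \<open>
  The derivative of order \<open>k\<close> of \<open>p E\<close> is \<open>p^(k) E + wave_R h p k * exp h\<close>,
  where \<open>E' = exp h / p^2\<close>.
\<close>

primrec wave_R :: "complex poly \<Rightarrow> complex poly \<Rightarrow> nat \<Rightarrow> complex poly fract" where
  "wave_R h p 0 = 0"
| "wave_R h p (Suc k) =
     wave_D h (wave_R h p k) + to_fract ((pderiv ^^ k) p) * inverse (to_fract p ^ 2)"

lemma wave_R_1: "p \<noteq> 0 \<Longrightarrow> wave_R h p (Suc 0) = inverse (to_fract p)"
  by (simp add: wave_D_def power2_eq_square)

lemma fract_deriv_pderiv_cubic:
  "fract_deriv (to_fract (pderiv [:0, a :: 'a::field_char_0, 0, 1/3:])) = 2 * to_fract [:0, 1:]"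
proof -
  have "pderiv (pderiv [:0, a, 0, 1/3:]) = 2 * [:0, 1:]"
    by (simp add: pderiv_pCons numeral_poly)
  then show ?thesis
    by (simp flip: to_fract_of_nat[of 2, simplified] to_fract_mult)
qed

text \<open>The derivatives of \<open>p\<close> satisfy the recurrence, so the source contributes
  nothing and the recurrence for the \<open>exp h\<close> part propagates from order 0.\<close>

lemma wave_rec_wave_R:
  fixes a b :: complex and h p :: "complex poly" and n :: nat
  defines "X \<equiv> to_fract [:0, 1:]" and "H \<equiv> to_fract (pderiv h)"
    and "B \<equiv> to_fract [:b:]"
  assumes p: "p \<noteq> 0" and h: "h = [:0, a, 0, 1/3:]"
    and ode: "pderiv (pderiv p) - pderiv h * pderiv p + [:b, of_nat n:] * p = 0"
  shows "wave_rec H X B (of_nat n) (wave_R h p) k = 0"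
proof -
  let ?d = "\<lambda>k. to_fract ((pderiv ^^ k) p)"
  have H: "fract_deriv H = 2 * X"
    unfolding H_def X_def h by (rule fract_deriv_pderiv_cubic)
  have X: "fract_deriv X = 1"
    by (simp add: X_def pderiv_pCons flip: to_fract_1 one_pCons)
  have B: "fract_deriv B = 0"
    by (simp add: B_def)
  have lin: "to_fract [:b, of_nat n:] = of_nat n * X + B"
    by (simp add: X_def B_def of_nat_poly flip: to_fract_of_nat to_fract_mult to_fract_add)
  note step = wave_rec_Suc[OF H X B fract_deriv_of_nat[of n]]
  have d: "wave_rec H X B (of_nat n) ?d k = 0" for k
  proof (induction k)
    case 0
    show ?case
      using arg_cong[OF ode, of to_fract]
      unfolding to_fract_add to_fract_diff to_fract_mult lin by (simp add: wave_rec_def H_def)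
  next
    case (Suc k)
    then show ?case
      using step[of ?d 0 "\<lambda>_. 0" 0 k] by simp
  qed
  show ?thesis
  proof (induction k)
    case 0
    \<comment> \<open>The source \<open>p' / p^2\<close> cancels the derivative of
      \<open>1 / p\<close>.\<close>
    have "wave_R h p (Suc (Suc 0)) = H * wave_R h p (Suc 0)"
      unfolding wave_R.simps(2)[of h p "Suc 0"] wave_R_1[OF p]
      using p by (simp add: wave_D_def fract_deriv_inverse H_def)
    then show ?case
      by (simp add: wave_rec_def)
  next
    case (Suc k)
    then show ?case
      using step[of "wave_R h p" H ?d "inverse (to_fract p ^ 2)" k] d
      by (simp add: wave_D_def H_def)
  qed
qed

text \<open>Serves to show that \<open>wave_R h p (Suc n)\<close> is nonzero. Up to lower-degree
  terms, each step multiplies the numerator by \<open>h' p\<close>.\<close>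

lemma wave_R_numerator:
  assumes p: "p \<noteq> 0" and deg: "degree (pderiv h) = 2"
  shows "\<exists>q. wave_R h p (Suc k) * to_fract p ^ Suc k = to_fract q \<and> q \<noteq> 0
    \<and> degree q = k * (degree p + 2)"
proof (induction k)
  case 0
  show ?case
    by (rule exI[of _ 1]) (use p wave_R_1[OF p] in simp)
next
  case (Suc k)
  then obtain q where q: "wave_R h p (Suc k) * to_fract p ^ Suc k = to_fract q" "q \<noteq> 0"
    "degree q = k * (degree p + 2)" by blast
  define R where "R = wave_R h p (Suc k)"
  have qR: "R * to_fract p ^ Suc k = to_fract q"
    unfolding R_def by (rule q(1))
  let ?P = "to_fract p"
  \<comment> \<open>The part of the next numerator without the factor \<open>h'\<close>; its degree
    is at least 2 below that of \<open>h' q p\<close>.\<close>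
  define l where "l = pderiv q * p - of_nat (Suc k) * (pderiv p * q) + (pderiv ^^ Suc k) p * p ^ k"
  have "fract_deriv (?P ^ Suc k) = of_nat (Suc k) * ?P ^ k * to_fract (pderiv p)"
    by (simp only: fract_deriv_power_Suc fract_deriv_to_fract)
  then have "fract_deriv R * ?P ^ Suc k + R * (of_nat (Suc k) * ?P ^ k * to_fract (pderiv p))
      = to_fract (pderiv q)"
    using arg_cong[OF qR, of fract_deriv] by (simp only: fract_deriv_mult fract_deriv_to_fract)
  then have "(fract_deriv R * ?P ^ Suc k + R * (of_nat (Suc k) * ?P ^ k * to_fract (pderiv p))) * ?P
      = to_fract (pderiv q) * ?P"
    by (simp only:)
  then have "fract_deriv R * ?P ^ Suc (Suc k) + of_nat (Suc k) * to_fract (pderiv p) * (R * ?P ^ Suc k)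
      = to_fract (pderiv q) * ?P"
    by (simp add: algebra_simps)
  then have dR: "fract_deriv R * ?P ^ Suc (Suc k)
      = to_fract (pderiv q * p - of_nat (Suc k) * (pderiv p * q))"
    unfolding qR to_fract_diff to_fract_mult to_fract_of_nat eq_diff_eq by (simp only: mult.assoc)
  have inv: "inverse (?P ^ 2) * ?P ^ Suc (Suc k) = ?P ^ k"
  proof -
    have "?P ^ Suc (Suc k) = ?P ^ 2 * ?P ^ k"
      by (simp add: power2_eq_square)
    moreover have "inverse (?P ^ 2) * ?P ^ 2 = 1"
      using p by (intro left_inverse) simp
    ultimately show ?thesis
      by (simp only: mult.assoc[symmetric] mult_1_left)
  qed
  have "wave_R h p (Suc (Suc k)) * ?P ^ Suc (Suc k)
    = fract_deriv R * ?P ^ Suc (Suc k) + to_fract (pderiv h) * (R * ?P ^ Suc k) * ?P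
      + to_fract ((pderiv ^^ Suc k) p) * ?P ^ k"
    unfolding wave_R.simps(2)[of h p "Suc k"] R_def[symmetric] wave_D_def distrib_right
      mult.assoc[of _ "inverse (?P ^ 2)"] inv
    by (simp add: mult_ac del: funpow.simps)
  also have "\<dots> = to_fract (l + pderiv h * q * p)"
    unfolding dR qR l_def by (simp del: funpow.simps)
  finally have eq: "wave_R h p (Suc (Suc k)) * ?P ^ Suc (Suc k) = to_fract (l + pderiv h * q * p)" .
  have hn: "pderiv h \<noteq> 0"
    using deg by auto
  have top: "degree (pderiv h * q * p) = Suc k * (degree p + 2)"
    using p q hn deg by (simp add: degree_mult_eq)
  have iter: "degree ((pderiv ^^ j) p) \<le> degree p" for j
    by (induction j) (auto simp: degree_pderiv)
  have pd: "degree (pderiv f) \<le> degree f" for f :: "complex poly"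
    by (simp add: degree_pderiv)
  have "degree l \<le> k * (degree p + 2) + degree p"
    unfolding l_def
  proof (intro degree_add_le degree_diff_le)
    show "degree (pderiv q * p) \<le> k * (degree p + 2) + degree p"
      using degree_mult_le[of "pderiv q" p] pd[of q] q(3) by linarith
    have "degree (of_nat (Suc k) * (pderiv p * q)) \<le> degree (pderiv p * q)"
      using degree_mult_le[of "of_nat (Suc k)" "pderiv p * q"] by (simp only: degree_of_nat add_0)
    then show "degree (of_nat (Suc k) * (pderiv p * q)) \<le> k * (degree p + 2) + degree p"
      using degree_mult_le[of "pderiv p" q] pd[of p] q(3) by linarith
    have "degree (p ^ k) \<le> k * (degree p + 2)"
      using p by (simp add: degree_power_eq)
    then show "degree ((pderiv ^^ Suc k) p * p ^ k) \<le> k * (degree p + 2) + degree p"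
      using degree_mult_le[of "(pderiv ^^ Suc k) p" "p ^ k"] iter[of "Suc k"] by linarith
  qed
  then have "degree l < degree (pderiv h * q * p)"
    unfolding top by simp
  then have "degree (l + pderiv h * q * p) = Suc k * (degree p + 2)"
    using top by (simp add: degree_add_eq_right)
  moreover from this have "l + pderiv h * q * p \<noteq> 0"
    by auto
  ultimately show ?case
    using eq by blast
qed

section \<open>The equation of the reflected polynomial\<close>

text \<open>Under \<open>x -> -x\<close> the even \<open>h'\<close> is fixed, while the first
  derivative and \<open>n x\<close> change sign.\<close>

lemma wave_polynomial_reflect:
  fixes p :: "complex poly"
  defines "P \<equiv> pcompose p [:0, -1:]"
  assumes h: "h = [:0, a, 0, 1/3:]"
    and ode: "pderiv (pderiv p) - pderiv h * pderiv p + [:b, of_nat n:] * p = 0"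
  shows "pderiv (pderiv P) + pderiv h * pderiv P + [:b, - of_nat n:] * P = 0"
proof -
  have "pcompose (pderiv h) [:0, -1:] = pderiv h"
    by (simp add: h pderiv_pCons pcompose_pCons)
  moreover have "pcompose [:b, of_nat n:] [:0, -1:] = [:b, - of_nat n:]"
    by (simp add: pcompose_pCons)
  ultimately show ?thesis
    using arg_cong[OF ode, of "\<lambda>q. pcompose q [:0, -1:]"]
    unfolding pcompose_diff pcompose_add pcompose_mult
    by (simp add: P_def pderiv_pcompose pderiv_minus pderiv_pCons)
qed

lemma wave_polynomial_reflect_sim:
  fixes p :: "complex poly"
  assumes h: "h = [:0, a, 0, 1/3:]" and "wave_polynomial h n p"
  shows "\<exists>c. wave_sim h (to_fract (pcompose p [:0, -1:])) (to_fract [:c:] * inverse (to_fract p ^ 2))"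
proof -
  from assms obtain b where p: "p \<noteq> 0"
    and ode: "pderiv (pderiv p) - pderiv h * pderiv p + [:b, of_nat n:] * p = 0"
    unfolding wave_polynomial_def by blast
  have deg: "degree p = n"
    using assms wave_polynomial_degree by blast
  define X H B P where "X = to_fract [:0, 1 :: complex:]" and "H = to_fract (pderiv h)"
    and "B = to_fract [:b:]" and "P = to_fract (pcompose p [:0, -1:])"
  define S where "S = wave_R h p (Suc n)"
  have h': "pderiv h = [:a, 0, 1:]"
    by (simp add: h pderiv_pCons)
  have h'': "fract_deriv H = 2 * X"
    unfolding H_def X_def h by (rule fract_deriv_pderiv_cubic)
  have "degree ((pderiv ^^ n) p) = 0"
    unfolding deg[symmetric] degree_higher_pderiv by simp
  then obtain c where c: "(pderiv ^^ n) p = [:c:]"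
    by (metis degree_eq_zeroE)
  have z: "(pderiv ^^ Suc n) p = 0" "(pderiv ^^ Suc (Suc n)) p = 0"
    by (simp_all add: c)
  \<comment> \<open>Past order \<open>n\<close> the source vanishes and only \<open>wave_D h\<close>
    acts.\<close>
  have S1: "wave_R h p (Suc (Suc n)) = wave_D h S"
    and S2: "wave_R h p (Suc (Suc (Suc n))) = wave_D h (wave_D h S)"
    using z by (simp_all add: S_def)
  have P: "P \<noteq> 0"
    using p by (simp add: P_def pcompose_eq_0_iff)
  \<comment> \<open>At \<open>k = n + 1\<close> the coefficient \<open>k (n + 1 - k)\<close> is
    zero, which leaves an equation in \<open>S\<close> alone.\<close>
  have "wave_rec H X B (of_nat n) (wave_R h p) (Suc n) = 0"
    using wave_rec_wave_R[OF p h ode] by (simp add: X_def H_def B_def)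
  then have "wave_D h (wave_D h S) - H * wave_D h S + ((of_nat n - 2 * of_nat (Suc n)) * X + B) * S = 0"
    by (simp add: wave_rec_def S1[unfolded S_def] S2[unfolded S_def] S_def[symmetric] del: wave_R.simps)
  \<comment> \<open>Expanding \<open>wave_D\<close> twice produces \<open>H' S = 2 X S\<close>,
    which turns \<open>- (n + 2) X\<close> into \<open>- n X\<close>: the equation of
    \<open>P\<close>.\<close>
  then have odeS: "fract_deriv (fract_deriv S) + H * fract_deriv S + (B - of_nat n * X) * S = 0"
    by (simp add: wave_D_def fract_deriv_add fract_deriv_mult h'' algebra_simps flip: H_def)
  have lin: "to_fract [:b, - of_nat n:] = B - of_nat n * X"
    by (simp add: X_def B_def of_nat_poly flip: to_fract_of_nat to_fract_mult to_fract_diff)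
  have odeP: "fract_deriv (fract_deriv P) + H * fract_deriv P + (B - of_nat n * X) * P = 0"
    using arg_cong[OF wave_polynomial_reflect[OF h ode], of to_fract]
    unfolding to_fract_add to_fract_mult lin by (simp add: P_def H_def)
  \<comment> \<open>The Wronskian of two solutions of the same equation; once it vanishes,
    \<open>S / P\<close> is constant.\<close>
  define W where "W = fract_deriv S * P - S * fract_deriv P"
  have "fract_deriv W + H * W
    = (fract_deriv (fract_deriv S) + H * fract_deriv S + (B - of_nat n * X) * S) * P
      - S * (fract_deriv (fract_deriv P) + H * fract_deriv P + (B - of_nat n * X) * P)"
    by (simp add: W_def fract_deriv_diff fract_deriv_mult algebra_simps)
  then have "fract_deriv W + H * W = 0"
    unfolding odeS odeP by simp
  then have "W = 0"
    using rational_homogeneous_ode_trivial[of W "pderiv h"] by (simp add: H_def h')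
  moreover have "fract_deriv (S * inverse P) = W * inverse (P ^ 2)"
  proof -
    have "P * inverse (P ^ 2) = inverse P"
      using P by (simp add: power2_eq_square)
    then show ?thesis
      unfolding fract_deriv_mult fract_deriv_inverse[OF P] W_def left_diff_distrib mult.assoc
      by (simp only: mult_minus_left mult_minus_right diff_conv_add_uminus)
  qed
  ultimately have "fract_deriv (S * inverse P) = 0"
    by (simp only: mult_zero_left)
  from fract_deriv_eq_0D[OF this] obtain e where "S * inverse P = to_fract [:e:]" ..
  moreover have "S = S * inverse P * P"
    using P by (simp add: mult.assoc)
  ultimately have e: "S = to_fract [:e:] * P"
    by simp
  have "degree (pderiv h) = 2"
    by (simp add: h')
  from wave_R_numerator[OF p this, of n] have "S \<noteq> 0"
    unfolding S_def[symmetric] by (metis mult_zero_left to_fract_eq_0_iff)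
  then have "e \<noteq> 0"
    unfolding e by (metis mult_zero_left pCons_0_0 to_fract_0)
  then have "P = to_fract [:inverse e:] * S"
    unfolding e mult.assoc[symmetric] to_fract_mult[symmetric] by (simp flip: one_pCons)
  \<comment> \<open>The recursion of \<open>wave_R\<close> at order \<open>n\<close>, where the
    derivative of \<open>p\<close> is the constant \<open>c\<close>.\<close>
  moreover have "wave_sim h S (to_fract [:c:] * inverse (to_fract p ^ 2))"
    by (rule wave_simI[of _ _ _ "wave_R h p n"]) (simp add: S_def c)
  ultimately have "wave_sim h P (to_fract [:inverse e:] * (to_fract [:c:] * inverse (to_fract p ^ 2)))"
    by (simp only: wave_sim_scale)
  also have "to_fract [:inverse e:] * (to_fract [:c:] * inverse (to_fract p ^ 2))
    = to_fract [:inverse e * c:] * inverse (to_fract p ^ 2)"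
    unfolding mult.assoc[symmetric] to_fract_mult[symmetric] by simp
  finally show ?thesis
    unfolding P_def by blast
qed

section \<open>Reduction of the multiplier\<close>

lemma wave_sim_reduce_multiplier:
  assumes h': "pderiv h = [:a, 0, 1:]"
    and ode: "pderiv (pderiv P) + pderiv h * pderiv P + [:b, - of_nat n:] * P = 0"
    and r: "degree r \<le> m" and m: "m \<le> n"
  shows "\<exists>c. wave_sim h (to_fract (r * P)) (to_fract [:c:] * to_fract P)"
  using r m
proof (induction m arbitrary: r)
  case 0
  then obtain c where "r = [:c:]"
    by (metis degree_eq_zeroE le_zero_eq)
  then show ?case
    by (intro exI[of _ c] wave_simI[of _ _ _ 0]) (simp only: to_fract_mult, simp add: wave_D_def)
next
  case (Suc m)
  \<comment> \<open>The coefficient of \<open>x^(m+1)\<close> in \<open>M\<close> is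
    \<open>m - n\<close> times that of \<open>x^m\<close> in \<open>s\<close>, so this choice
    cancels the top term of \<open>r\<close>; \<open>m < n\<close> keeps the divisor
    nonzero.\<close>
  define s where "s = monom (coeff r (Suc m) / (of_nat m - of_nat n)) m"
  define M where "M = pderiv (pderiv s) + pderiv h * pderiv s + [:b, - of_nat n:] * s"
  define r' where "r' = r - M"
  have nm: "of_nat m - of_nat n \<noteq> (0::complex)"
    using Suc.prems by simp
  have "coeff r' k = 0" if k: "k > m" for k
  proof -
    obtain j where j: "k = Suc j" "j \<ge> m"
      using k by (cases k) auto
    have z: "coeff s (Suc i) = 0" if "i \<ge> m" for i
      using that by (simp add: s_def)
    \<comment> \<open>Only \<open>x^2 s'\<close> and \<open>- n x s\<close> contribute; the other
      terms involve coefficients of \<open>s\<close> beyond index \<open>m\<close>.\<close>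
    have M: "coeff M k = of_nat j * coeff s j - of_nat n * coeff s j"
      using j z[of j] z[of "Suc j"] z[of "Suc (Suc j)"]
      by (cases j) (simp_all add: M_def h' coeff_pderiv)
    show ?thesis
    proof (cases "j = m")
      case True
      then have "coeff M k = (of_nat m - of_nat n) * coeff s m"
        using M by (simp add: algebra_simps)
      also have "\<dots> = coeff r (Suc m)"
        using nm by (simp add: s_def)
      finally show ?thesis
        using j True by (simp add: r'_def)
    next
      case False
      with j Suc.prems have "coeff r k = 0"
        by (intro coeff_eq_0) simp
      with M j False show ?thesis
        by (simp add: r'_def s_def)
    qed
  qed
  then have "degree r' \<le> m"
    by (simp add: degree_le)
  then obtain c where c: "wave_sim h (to_fract (r' * P)) (to_fract [:c:] * to_fract P)"
    using Suc by fastforce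
  have "pderiv (pderiv s * P - s * pderiv P) + pderiv h * (pderiv s * P - s * pderiv P)
    = M * P - s * (pderiv (pderiv P) + pderiv h * pderiv P + [:b, - of_nat n:] * P)"
    unfolding M_def pderiv_diff pderiv_mult by (simp only: algebra_simps)
  then have "wave_D h (to_fract (pderiv s * P - s * pderiv P)) = to_fract (M * P)"
    unfolding ode by (simp only: wave_D_to_fract mult_zero_right diff_zero)
  then have "wave_sim h (to_fract (r * P)) (to_fract (r' * P))"
    by (intro wave_simI[of _ _ _ "to_fract (pderiv s * P - s * pderiv P)"])
      (simp add: r'_def algebra_simps)
  with c show ?case
    using wave_sim_trans by blast
qed

theorem theorem4p1:
  fixes a :: complex and h p r :: "complex poly" and n :: nat
  assumes "h = [:0, a, 0, 1/3:]"
    and "wave_polynomial h n p"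
    and "degree r \<le> n"
  shows "\<exists>c :: complex. wave_sim h (to_fract (r * pcompose p [:0, -1:]))
           (to_fract [:c:] / (to_fract p)^2)"
proof -
  define P where "P = pcompose p [:0, -1:]"
  from assms(2) obtain b
    where ode: "pderiv (pderiv p) - pderiv h * pderiv p + [:b, of_nat n:] * p = 0"
    unfolding wave_polynomial_def by blast
  have h': "pderiv h = [:a, 0, 1:]"
    by (simp add: assms(1) pderiv_pCons)
  from wave_sim_reduce_multiplier[OF h' wave_polynomial_reflect[OF assms(1) ode] assms(3) order_refl]
  obtain c where c: "wave_sim h (to_fract (r * P)) (to_fract [:c:] * to_fract P)"
    unfolding P_def ..
  obtain d where "wave_sim h (to_fract P) (to_fract [:d:] * inverse (to_fract p ^ 2))"
    using wave_polynomial_reflect_sim[OF assms(1,2)] unfolding P_def by blast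
  from wave_sim_trans[OF c wave_sim_scale[OF this]]
  have "wave_sim h (to_fract (r * P)) (to_fract [:d * c:] / to_fract p ^ 2)"
    by (simp add: divide_inverse flip: mult.assoc to_fract_mult)
  then show ?thesis
    unfolding P_def by blast
qed

end
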